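(* Let $(X,T,A)$ be a soft $T_{0U}$ topological space. Then $(X,T,A)$ is a soft $T_{(0,(TS)^k)}$ space if and only if for each $x,y\in X$ with $x\not\approx y$, there exists a soft clopen set $(G,A)$ such that $x\in(G,A)$ and $y\in(G,A)^c$, or there is a soft clopen set $(F,A)$ such that $y\in(F,A)$ and $x\in(F,A)^c$.
   Context: A soft set over a set $X$ with parameter set $A$ is a pair $(F,A)$ with $F:A\to\mathcal P(X)$; $SS(X)_A$ is the set of all of them. $0_A$ and $1_A$ denote the soft sets with constant value $\emptyset$, respectively $X$. Soft union, soft intersection $\sqcap$, complement $(F,A)^c$ and inclusion $\sqsubseteq$ are defined parameterwise. For $x\in X$, $x\in(F,A)$ means $x\in F(a)$ for all $a\in A$; so $x\in(F,A)^c$ means $x\notin F(a)$ for all $a\in A$. A soft topology on $X$ is a family $T\subseteq SS(X)_A$ containing $0_A,1_A$ and closed under binary soft intersections and arbitrary soft unions; members of $T$ are soft open, their complements are soft closed, and a soft set that is both is soft clopen. A soft neighbourhood of $x$ is a soft set $(F,A)$ such that $x\in(G,A)\sqsubseteq(F,A)$ for some $(G,A)\in T$; $\mathcal U_x$ is the collection of these. Write $x\approx y$ if $x\in(G,A)$ for each $(G,A)\in\mathcal U_y$ and $y\in(F,A)$ for each $(F,A)\in\mathcal U_x$. The space is soft $T_{0U}$ if whenever $x\approx y$, for every $a\in A$ and $(F,A)\in T$: $x\in F(a)$ if and only if $y\in F(a)$. Soft $T_0$ reflection: $X_0$ is the set of equivalence classes of $\approx$ on $X$, $r_X:X\to X_0$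 the canonical surjection, and $T_0$ is the soft topology on $X_0$ consisting of those $(F,A)\in SS(X_0)_A$ for which the soft set $a\mapsto r_X^{-1}(F(a))$ belongs to $T$; $(X_0,T_0,A)$ is the soft $T_0$ reflection of $(X,T,A)$. A soft topological space is soft $k$-totally separated if for all distinct points $x,y$ there is a soft clopen $(F,A)$ with $x\in(F,A)$, $y\in(F,A)^c$, or a soft clopen $(G,A)$ with $y\in(G,A)$, $x\in(G,A)^c$. $(X,T,A)$ is soft $T_{(0,(TS)^k)}$ if $(X_0,T_0,A)$ is soft $k$-totally separated. *)

theory Defs
  imports Main "HOL-Library.FuncSet"
begin

text \<open>A soft set over X with parameter set A is a map from A to the power set of X. It is
  represented by a function that is extensional on A, so that equality of soft sets is
  equality of HOL functions. Points and parameters range over explicit carriers because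
  the points of the reflection below are equivalence classes.\<close>

definition soft_sets :: "'x set \<Rightarrow> 'a set \<Rightarrow> ('a \<Rightarrow> 'x set) set" where
  "soft_sets X A = A \<rightarrow>\<^sub>E Pow X"

definition soft_empty :: "'a set \<Rightarrow> 'a \<Rightarrow> 'x set" where
  "soft_empty A = (\<lambda>a\<in>A. {})"

definition soft_full :: "'x set \<Rightarrow> 'a set \<Rightarrow> 'a \<Rightarrow> 'x set" where
  "soft_full X A = (\<lambda>a\<in>A. X)"

definition soft_inter :: "'a set \<Rightarrow> ('a \<Rightarrow> 'x set) \<Rightarrow> ('a \<Rightarrow> 'x set) \<Rightarrow> 'a \<Rightarrow> 'x set" where
  "soft_inter A F G = (\<lambda>a\<in>A. F a \<inter> G a)"

definition soft_Union :: "'a set \<Rightarrow> ('a \<Rightarrow> 'x set) set \<Rightarrow> 'a \<Rightarrow> 'x set" where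
  "soft_Union A C = (\<lambda>a\<in>A. \<Union>F\<in>C. F a)"

definition soft_compl :: "'x set \<Rightarrow> 'a set \<Rightarrow> ('a \<Rightarrow> 'x set) \<Rightarrow> 'a \<Rightarrow> 'x set" where
  "soft_compl X A F = (\<lambda>a\<in>A. X - F a)"

definition soft_subset :: "'a set \<Rightarrow> ('a \<Rightarrow> 'x set) \<Rightarrow> ('a \<Rightarrow> 'x set) \<Rightarrow> bool" where
  "soft_subset A F G \<longleftrightarrow> (\<forall>a\<in>A. F a \<subseteq> G a)"

text \<open>A point belongs to a soft set if it belongs to it for every parameter, so
  membership in the complement is stronger than non-membership.\<close>

definition soft_mem :: "'a set \<Rightarrow> 'x \<Rightarrow> ('a \<Rightarrow> 'x set) \<Rightarrow> bool" where
  "soft_mem A x F \<longleftrightarrow> (\<forall>a\<in>A. x \<in> F a)"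

definition soft_topology :: "'x set \<Rightarrow> ('a \<Rightarrow> 'x set) set \<Rightarrow> 'a set \<Rightarrow> bool" where
  "soft_topology X T A \<longleftrightarrow>
     T \<subseteq> soft_sets X A \<and>
     soft_empty A \<in> T \<and> soft_full X A \<in> T \<and>
     (\<forall>F\<in>T. \<forall>G\<in>T. soft_inter A F G \<in> T) \<and>
     (\<forall>C. C \<subseteq> T \<longrightarrow> soft_Union A C \<in> T)"

definition soft_closed :: "'x set \<Rightarrow> ('a \<Rightarrow> 'x set) set \<Rightarrow> 'a set \<Rightarrow> ('a \<Rightarrow> 'x set) \<Rightarrow> bool" where
  "soft_closed X T A F \<longleftrightarrow> (\<exists>G\<in>T. F = soft_compl X A G)"

definition soft_clopen :: "'x set \<Rightarrow> ('a \<Rightarrow> 'x set) set \<Rightarrow> 'a set \<Rightarrow> ('a \<Rightarrow> 'x set) \<Rightarrow> bool" where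
  "soft_clopen X T A F \<longleftrightarrow> F \<in> T \<and> soft_closed X T A F"

definition soft_nhds :: "'x set \<Rightarrow> ('a \<Rightarrow> 'x set) set \<Rightarrow> 'a set \<Rightarrow> 'x \<Rightarrow> ('a \<Rightarrow> 'x set) set" where
  "soft_nhds X T A x = {F \<in> soft_sets X A. \<exists>G\<in>T. soft_mem A x G \<and> soft_subset A G F}"

definition soft_indist :: "'x set \<Rightarrow> ('a \<Rightarrow> 'x set) set \<Rightarrow> 'a set \<Rightarrow> 'x \<Rightarrow> 'x \<Rightarrow> bool" where
  "soft_indist X T A x y \<longleftrightarrow>
     (\<forall>G\<in>soft_nhds X T A y. soft_mem A x G) \<and> (\<forall>F\<in>soft_nhds X T A x. soft_mem A y F)"

definition soft_T0U :: "'x set \<Rightarrow> ('a \<Rightarrow> 'x set) set \<Rightarrow> 'a set \<Rightarrow> bool" where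
  "soft_T0U X T A \<longleftrightarrow>
     (\<forall>x\<in>X. \<forall>y\<in>X. soft_indist X T A x y \<longrightarrow> (\<forall>a\<in>A. \<forall>F\<in>T. x \<in> F a \<longleftrightarrow> y \<in> F a))"

definition indist_rel :: "'x set \<Rightarrow> ('a \<Rightarrow> 'x set) set \<Rightarrow> 'a set \<Rightarrow> ('x \<times> 'x) set" where
  "indist_rel X T A = {(x, y). x \<in> X \<and> y \<in> X \<and> soft_indist X T A x y}"

definition refl_points :: "'x set \<Rightarrow> ('a \<Rightarrow> 'x set) set \<Rightarrow> 'a set \<Rightarrow> 'x set set" where
  "refl_points X T A = X // indist_rel X T A"

definition refl_map :: "'x set \<Rightarrow> ('a \<Rightarrow> 'x set) set \<Rightarrow> 'a set \<Rightarrow> 'x \<Rightarrow> 'x set" where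
  "refl_map X T A x = indist_rel X T A `` {x}"

definition refl_opens :: "'x set \<Rightarrow> ('a \<Rightarrow> 'x set) set \<Rightarrow> 'a set \<Rightarrow> ('a \<Rightarrow> 'x set set) set" where
  "refl_opens X T A =
     {F \<in> soft_sets (refl_points X T A) A. (\<lambda>a\<in>A. {x \<in> X. refl_map X T A x \<in> F a}) \<in> T}"

definition soft_k_totally_separated :: "'x set \<Rightarrow> ('a \<Rightarrow> 'x set) set \<Rightarrow> 'a set \<Rightarrow> bool" where
  "soft_k_totally_separated X T A \<longleftrightarrow>
     (\<forall>x\<in>X. \<forall>y\<in>X. x \<noteq> y \<longrightarrow>
        (\<exists>F. soft_clopen X T A F \<and> soft_mem A x F \<and> soft_mem A y (soft_compl X A F)) \<or>
        (\<exists>G. soft_clopen X T A G \<and> soft_mem A y G \<and> soft_mem A x (soft_compl X A G)))"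

definition soft_T0_k_totally_separated :: "'x set \<Rightarrow> ('a \<Rightarrow> 'x set) set \<Rightarrow> 'a set \<Rightarrow> bool" where
  "soft_T0_k_totally_separated X T A \<longleftrightarrow>
     soft_k_totally_separated (refl_points X T A) (refl_opens X T A) A"

lemma soft_indist_iff_open:
  assumes "soft_topology X T A"
  shows "soft_indist X T A x y \<longleftrightarrow> (\<forall>G\<in>T. soft_mem A x G \<longleftrightarrow> soft_mem A y G)"
proof -
  have "(\<forall>F\<in>soft_nhds X T A u. soft_mem A v F) \<longleftrightarrow> (\<forall>G\<in>T. soft_mem A u G \<longrightarrow> soft_mem A v G)"
    for u v
  proof
    assume *: "\<forall>F\<in>soft_nhds X T A u. soft_mem A v F"
    show "\<forall>G\<in>T. soft_mem A u G \<longrightarrow> soft_mem A v G"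
    proof (intro ballI impI)
      fix G assume G: "G \<in> T" "soft_mem A u G"
      moreover have "soft_subset A G G"
        by (simp add: soft_subset_def)
      moreover have "G \<in> soft_sets X A"
        using assms G(1) unfolding soft_topology_def by (meson subsetD)
      ultimately have "G \<in> soft_nhds X T A u"
        unfolding soft_nhds_def by blast
      with * show "soft_mem A v G"
        by blast
    qed
  next
    assume *: "\<forall>G\<in>T. soft_mem A u G \<longrightarrow> soft_mem A v G"
    show "\<forall>F\<in>soft_nhds X T A u. soft_mem A v F"
    proof
      fix F assume "F \<in> soft_nhds X T A u"
      then obtain G where "G \<in> T" "soft_mem A u G" and GF: "soft_subset A G F"
        unfolding soft_nhds_def by blast
      with * have "soft_mem A v G"
        by blast
      with GF show "soft_mem A v F"
        unfolding soft_mem_def soft_subset_def by blast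
    qed
  qed
  then show ?thesis
    unfolding soft_indist_def by metis
qed

lemma equiv_indist_rel:
  assumes "soft_topology X T A"
  shows "equiv X (indist_rel X T A)"
  unfolding indist_rel_def soft_indist_iff_open[OF assms]
  by (rule equivI) (auto simp: refl_on_def sym_def trans_def)

lemma soft_topology_refl:
  assumes "soft_topology X T A"
  shows "soft_topology (refl_points X T A) (refl_opens X T A) A"
proof -
  let ?X0 = "refl_points X T A" and ?T0 = "refl_opens X T A"
  define p where "p F = (\<lambda>a\<in>A. {x \<in> X. refl_map X T A x \<in> F a})" for F :: "'b \<Rightarrow> 'a set set"
  have T0: "?T0 = {F \<in> soft_sets ?X0 A. p F \<in> T}"
    by (simp add: refl_opens_def p_def)
  have mem: "refl_map X T A x \<in> ?X0" if "x \<in> X" for x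
    using that by (simp add: refl_map_def refl_points_def quotientI)
  have "p (soft_empty A) = soft_empty A"
    by (auto simp: p_def soft_empty_def fun_eq_iff restrict_def)
  moreover have "p (soft_full ?X0 A) = soft_full X A"
    using mem by (auto simp: p_def soft_full_def fun_eq_iff restrict_def)
  moreover have "p (soft_inter A F G) = soft_inter A (p F) (p G)" for F G
    by (auto simp: p_def soft_inter_def fun_eq_iff restrict_def)
  moreover have "p (soft_Union A C) = soft_Union A (p ` C)" for C
    by (auto simp: p_def soft_Union_def fun_eq_iff restrict_def)
  moreover have "p ` C \<subseteq> T" if "C \<subseteq> ?T0" for C
    using that by (auto simp: T0)
  moreover have "soft_empty A \<in> soft_sets ?X0 A" "soft_full ?X0 A \<in> soft_sets ?X0 A"
    by (auto simp: soft_empty_def soft_full_def soft_sets_def)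
  moreover have "soft_inter A F G \<in> soft_sets ?X0 A" if "F \<in> ?T0" for F G
  proof -
    have "F a \<subseteq> ?X0" if "a \<in> A" for a
      using \<open>F \<in> ?T0\<close> that by (auto simp: T0 soft_sets_def PiE_iff)
    then show ?thesis
      unfolding soft_inter_def soft_sets_def by (auto simp: PiE_iff)
  qed
  moreover have "soft_Union A C \<in> soft_sets ?X0 A" if "C \<subseteq> ?T0" for C
  proof -
    have "F a \<subseteq> ?X0" if "F \<in> C" "a \<in> A" for F a
    proof -
      have "F \<in> soft_sets ?X0 A"
        using \<open>C \<subseteq> ?T0\<close> \<open>F \<in> C\<close> T0 by auto
      with \<open>a \<in> A\<close> show ?thesis
        by (auto simp: soft_sets_def PiE_iff)
    qed
    then show ?thesis
      unfolding soft_Union_def soft_sets_def by (auto simp: PiE_iff)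
  qed
  ultimately show ?thesis
    using assms unfolding soft_topology_def by (simp add: T0 subset_iff)
qed

end

theory Submission
  imports Defs
begin

text \<open>Pulling soft sets back along the canonical surjection r: X \<rightarrow> X0 commutes with complements
  and with membership of points, and by the very definition of the reflected topology a soft set
  is open in X0 exactly when its pullback is open. Hence a soft set of X0 is clopen exactly when
  its pullback is, and it separates r x from r y exactly when its pullback separates x from y
  (lemmas \<open>soft_clopen_pullback_iff\<close>, \<open>soft_mem_pullback\<close>, \<open>soft_mem_compl_pullback\<close>).

  So separations in X0 yield separations in X. For the converse, a clopen soft set of X
  has to come from X0. This is where T0U enters: it says that every open soft set is, parameter
  by parameter, a union of equivalence classes, and therefore the pullback of its image
  (\<open>open_eq_pullback_image\<close>). Finally, distinct points of X0 are the images of points that are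
  not indistinguishable, so the two separation conditions range over the same pairs.\<close>

definition soft_pullback ::
  "'x set \<Rightarrow> ('a \<Rightarrow> 'x set) set \<Rightarrow> 'a set \<Rightarrow> ('a \<Rightarrow> 'x set set) \<Rightarrow> 'a \<Rightarrow> 'x set" where
  "soft_pullback X T A F = (\<lambda>a\<in>A. {x \<in> X. refl_map X T A x \<in> F a})"

lemma refl_points_eq_image: "refl_points X T A = refl_map X T A ` X"
  by (auto simp: refl_points_def refl_map_def quotient_def)

lemma refl_map_eq_iff:
  assumes "soft_topology X T A" "x \<in> X" "y \<in> X"
  shows "refl_map X T A x = refl_map X T A y \<longleftrightarrow> soft_indist X T A x y"
  using eq_equiv_class_iff[OF equiv_indist_rel[OF assms(1)] assms(2,3)] assms(2,3)
  by (simp add: refl_map_def indist_rel_def)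

lemma soft_compl_in_soft_sets: "soft_compl X A F \<in> soft_sets X A"
  by (auto simp: soft_compl_def soft_sets_def)

lemma soft_compl_compl:
  assumes "F \<in> soft_sets X A"
  shows "soft_compl X A (soft_compl X A F) = F"
proof
  fix a
  show "soft_compl X A (soft_compl X A F) a = F a"
    using assms by (cases "a \<in> A") (auto simp: soft_compl_def soft_sets_def PiE_iff extensional_def)
qed

lemma refl_opens_iff:
  "F \<in> refl_opens X T A \<longleftrightarrow> F \<in> soft_sets (refl_points X T A) A \<and> soft_pullback X T A F \<in> T"
  by (simp add: refl_opens_def soft_pullback_def)

lemma soft_pullback_compl:
  "soft_pullback X T A (soft_compl (refl_points X T A) A F) = soft_compl X A (soft_pullback X T A F)"
  by (auto simp: soft_pullback_def soft_compl_def refl_points_eq_image fun_eq_iff restrict_def)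

lemma soft_mem_pullback:
  assumes "x \<in> X"
  shows "soft_mem A x (soft_pullback X T A F) \<longleftrightarrow> soft_mem A (refl_map X T A x) F"
  using assms by (simp add: soft_mem_def soft_pullback_def)

lemma soft_mem_compl_pullback:
  assumes "x \<in> X"
  shows "soft_mem A x (soft_compl X A (soft_pullback X T A F)) \<longleftrightarrow>
    soft_mem A (refl_map X T A x) (soft_compl (refl_points X T A) A F)"
  using soft_mem_pullback[OF assms] by (simp flip: soft_pullback_compl)

text \<open>In terms of openness of the complement, clopenness transfers along pullbacks at once.\<close>

lemma soft_clopen_iff_compl_open:
  assumes "T \<subseteq> soft_sets X A"
  shows "soft_clopen X T A F \<longleftrightarrow> F \<in> T \<and> soft_compl X A F \<in> T"
proof -
  have "soft_compl X A (soft_compl X A G) = G" if "G \<in> T" for G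
    using assms that soft_compl_compl by blast
  then show ?thesis
    unfolding soft_clopen_def soft_closed_def by metis
qed

lemma soft_clopen_pullback_iff:
  assumes "soft_topology X T A" "F \<in> soft_sets (refl_points X T A) A"
  shows "soft_clopen X T A (soft_pullback X T A F) \<longleftrightarrow>
    soft_clopen (refl_points X T A) (refl_opens X T A) A F"
proof -
  have "T \<subseteq> soft_sets X A"
    using assms(1) by (simp add: soft_topology_def)
  moreover have "refl_opens X T A \<subseteq> soft_sets (refl_points X T A) A"
    by (auto simp: refl_opens_iff)
  ultimately show ?thesis
    using assms(2)
    by (simp add: soft_clopen_iff_compl_open refl_opens_iff soft_pullback_compl
        soft_compl_in_soft_sets)
qed

text \<open>A point whose class meets \<open>G a\<close> is indistinguishable from a point of \<open>G a\<close>; T0U puts it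
  into \<open>G a\<close> itself, for this single parameter. Indistinguishability alone would only compare
  membership for all parameters at once.\<close>

lemma open_eq_pullback_image:
  assumes top: "soft_topology X T A" and T0U: "soft_T0U X T A" and G: "G \<in> T"
  shows "soft_pullback X T A (\<lambda>a\<in>A. refl_map X T A ` G a) = G"
proof
  fix a
  have GX: "G \<in> soft_sets X A"
    using top G by (auto simp: soft_topology_def)
  show "soft_pullback X T A (\<lambda>a\<in>A. refl_map X T A ` G a) a = G a"
  proof (cases "a \<in> A")
    case True
    then have sub: "G a \<subseteq> X"
      using GX by (auto simp: soft_sets_def PiE_iff)
    have "x \<in> G a" if "x \<in> X" "y \<in> G a" "refl_map X T A x = refl_map X T A y" for x y
    proof -
      have "y \<in> X"
        using sub that(2) by blast
      moreover from this have "soft_indist X T A x y"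
        using refl_map_eq_iff[OF top] that by blast
      ultimately show ?thesis
        using T0U that(1,2) True G unfolding soft_T0U_def by blast
    qed
    with True sub show ?thesis
      by (auto simp: soft_pullback_def)
  next
    case False
    with GX show ?thesis
      by (auto simp: soft_pullback_def soft_sets_def PiE_iff extensional_def)
  qed
qed

lemma clopen_separation_refl_iff:
  assumes top: "soft_topology X T A" and T0U: "soft_T0U X T A" and x: "x \<in> X" and y: "y \<in> X"
  shows "(\<exists>F. soft_clopen (refl_points X T A) (refl_opens X T A) A F \<and>
        soft_mem A (refl_map X T A x) F \<and>
        soft_mem A (refl_map X T A y) (soft_compl (refl_points X T A) A F)) \<longleftrightarrow>
    (\<exists>G. soft_clopen X T A G \<and> soft_mem A x G \<and> soft_mem A y (soft_compl X A G))"
    (is "?L \<longleftrightarrow> ?R")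
proof
  assume ?L
  then obtain F where F: "soft_clopen (refl_points X T A) (refl_opens X T A) A F"
      "soft_mem A (refl_map X T A x) F"
      "soft_mem A (refl_map X T A y) (soft_compl (refl_points X T A) A F)"
    by blast
  moreover from F(1) have "F \<in> soft_sets (refl_points X T A) A"
    by (simp add: soft_clopen_def refl_opens_iff)
  ultimately show ?R
    using soft_clopen_pullback_iff[OF top] soft_mem_pullback[OF x] soft_mem_compl_pullback[OF y]
    by metis
next
  assume ?R
  then obtain G where G: "soft_clopen X T A G" "soft_mem A x G" "soft_mem A y (soft_compl X A G)"
    by blast
  then have "G \<in> T"
    by (simp add: soft_clopen_def)
  define F where "F = (\<lambda>a\<in>A. refl_map X T A ` G a)"
  have pull: "soft_pullback X T A F = G"
    unfolding F_def using open_eq_pullback_image[OF top T0U \<open>G \<in> T\<close>] .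
  have "G \<in> soft_sets X A"
    using top \<open>G \<in> T\<close> by (auto simp: soft_topology_def)
  then have "F \<in> soft_sets (refl_points X T A) A"
    by (fastforce simp: F_def soft_sets_def PiE_iff refl_points_eq_image)
  then show ?L
    using G soft_clopen_pullback_iff[OF top] soft_mem_pullback[OF x] soft_mem_compl_pullback[OF y] pull
    by metis
qed

theorem proposition4p9:
  fixes X :: "'x set" and T :: "('a \<Rightarrow> 'x set) set" and A :: "'a set"
  assumes "soft_topology X T A"
    and "soft_T0U X T A"
  shows "soft_T0_k_totally_separated X T A \<longleftrightarrow>
    (\<forall>x\<in>X. \<forall>y\<in>X. \<not> soft_indist X T A x y \<longrightarrow>
       (\<exists>G. soft_clopen X T A G \<and> soft_mem A x G \<and> soft_mem A y (soft_compl X A G)) \<or>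
       (\<exists>F. soft_clopen X T A F \<and> soft_mem A y F \<and> soft_mem A x (soft_compl X A F)))"
proof -
  have *: "soft_k_totally_separated (refl_points X T A) T0 A \<longleftrightarrow>
    (\<forall>x\<in>X. \<forall>y\<in>X. refl_map X T A x \<noteq> refl_map X T A y \<longrightarrow>
      (\<exists>F. soft_clopen (refl_points X T A) T0 A F \<and> soft_mem A (refl_map X T A x) F \<and>
        soft_mem A (refl_map X T A y) (soft_compl (refl_points X T A) A F)) \<or>
      (\<exists>G. soft_clopen (refl_points X T A) T0 A G \<and> soft_mem A (refl_map X T A y) G \<and>
        soft_mem A (refl_map X T A x) (soft_compl (refl_points X T A) A G)))" for T0
    unfolding soft_k_totally_separated_def refl_points_eq_image by (simp only: ball_simps)
  show ?thesis
    unfolding soft_T0_k_totally_separated_def *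
    by (simp add: refl_map_eq_iff[OF assms(1)] clopen_separation_refl_iff[OF assms] cong: ball_cong)
qed

end
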